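(* Assume $S$ is symmetric. Then there exist polynomials $N^+(z),N^-(z)\in K[z]$ and $\widetilde N^+(u,z),\widetilde N^-(u,z)\in K[u,z]$ such that, as formal power series, $$\sum_{k\ge0}F_k^+z^k=\frac{N^+(z)}{D(z^2)},\qquad \sum_{k\ge0}F_k^-z^k=\frac{N^-(z)}{D(z^2)},$$ $$\sum_{k\ge0}\ \sum_{0\le\ell\le k/2}F^+_{k,\ell}u^\ell z^k=\frac{\widetilde N^+(u,z)}{\widetilde D(uz^2)D(z^2)},\qquad \sum_{k\ge0}\ \sum_{0\le\ell<k/2}F^-_{k,\ell}u^\ell z^k=\frac{\widetilde N^-(u,z)}{\widetilde D(uz^2)D(z^2)}.$$
   Context: Let $S$ be a finite set of integers with $a:=\max S\ge1$ and $b:=-\min S$; each $s\in S$ carries a weight $\omega_s$ in a field $K$ of characteristic $0$; set $\omega_s:=0$ for $s\notin S$. $S$ is called symmetric if $-S=S$ and $\omega_{-s}=\omega_s$ for all $s\in S$ (so $b=a$). For $s\in\mathbb Z$ put $\beta_s:=\delta_{s,0}-\omega_s$ and $\widetilde\beta_s:=-\beta_{s+1}$. Notation: $[m,n]:=\{i\in\mathbb Z: m\le i\le n\}$, $X+c:=\{x+c:x\in X\}$; an $n$-subset is a subset of cardinality $n$; for a finite $I\subseteq\mathbb Z$ and $s\in\mathbb Z$, $\epsilon_s(I):=(-1)^{\#\{i\in I:\ i<s\}}$. $\mathbf T$ is the square matrix indexed by the $a$-subsets of $[-b,a-1]$ with $\mathbf T[I,J]:=\epsilon_s(I)\beta_s$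 if there is an integer $s$ with $I\cup\{a\}=(J+1)\cup\{s\}$, and $0$ otherwise; $\widetilde{\mathbf T}$ is the square matrix indexed by the $(a-1)$-subsets of $[-b-1,a-2]$ with $\widetilde{\mathbf T}[I,J]:=\epsilon_s(I)\widetilde\beta_s$ if there is an integer $s$ with $I\cup\{a-1\}=(J+1)\cup\{s\}$, and $0$ otherwise. $D(z):=\det(1-z\mathbf T)$ and $\widetilde D(z):=\det(1-z\widetilde{\mathbf T})$. For $k\ge0$, $A_k^+$ is the matrix with rows and columns indexed by the integers $0\le i,j\le k/2$ and entries $\omega_{j-i}+\omega_{k-j-i}$ if $j<k/2$ and $\omega_{j-i}$ if $j=k/2$; $A_k^-$ is the matrix with rows and columns indexed by the integers $0\le i,j<k/2$ and entries $\omega_{j-i}-\omega_{k-j-i}$. The determinant of an empty matrix is $1$. Put $F^\pm_0:=1$ and $F^\pm_k:=\det(1-A^\pm_{k-1})$ for $k\ge1$. For an index $\ell$ of $A^\pm_k$, $F^\pm_{k,\ell}$ is the $(\ell,0)$ cofactor of $1-A_k^\pm$, i.e. $(-1)^\ell$ times the determinant of $1-A_k^\pm$ with row $\ell$ and column $0$ deleted. *)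

theory Defs
  imports "Jordan_Normal_Form.Determinant" "HOL-Computational_Algebra.Formal_Power_Series"
    "HOL-Computational_Algebra.Polynomial_FPS" "HOL-Combinatorics.Permutations"
begin

definition detS :: "'i set \<Rightarrow> ('i \<Rightarrow> 'i \<Rightarrow> 'b::comm_ring_1) \<Rightarrow> 'b" where
  "detS Idx M = (\<Sum>p | p permutes Idx. of_int (sign p) * (\<Prod>i\<in>Idx. M i (p i)))"

definition aS :: "int set \<Rightarrow> int" where "aS S = Max S"
definition bS :: "int set \<Rightarrow> int" where "bS S = - Min S"

definition beta :: "(int \<Rightarrow> 'a::field) \<Rightarrow> int \<Rightarrow> 'a" where
  "beta \<omega> s = (if s = 0 then 1 else 0) - \<omega> s"

definition betat :: "(int \<Rightarrow> 'a::field) \<Rightarrow> int \<Rightarrow> 'a" where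
  "betat \<omega> s = - beta \<omega> (s + 1)"

definition eps :: "int \<Rightarrow> int set \<Rightarrow> 'a::ring_1" where
  "eps s I = (-1) ^ card {i \<in> I. i < s}"

definition subsets_of :: "nat \<Rightarrow> int \<Rightarrow> int \<Rightarrow> int set set" where
  "subsets_of n lo hi = {I. I \<subseteq> {lo..hi} \<and> card I = n}"

definition tentry :: "(int \<Rightarrow> 'a::field) \<Rightarrow> int \<Rightarrow> int set \<Rightarrow> int set \<Rightarrow> 'a" where
  "tentry bt tp I J =
     (if \<exists>s. insert tp I = insert s ((\<lambda>j. j + 1) ` J)
      then (let s = (THE s. insert tp I = insert s ((\<lambda>j. j + 1) ` J)) in eps s I * bt s)
      else 0)"

definition Tmat :: "int set \<Rightarrow> (int \<Rightarrow> 'a::field) \<Rightarrow> int set \<Rightarrow> int set \<Rightarrow> 'a" where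
  "Tmat S \<omega> I J = tentry (beta \<omega>) (aS S) I J"

definition Tidx :: "int set \<Rightarrow> int set set" where
  "Tidx S = subsets_of (nat (aS S)) (- bS S) (aS S - 1)"

definition Ttmat :: "int set \<Rightarrow> (int \<Rightarrow> 'a::field) \<Rightarrow> int set \<Rightarrow> int set \<Rightarrow> 'a" where
  "Ttmat S \<omega> I J = tentry (betat \<omega>) (aS S - 1) I J"

definition Ttidx :: "int set \<Rightarrow> int set set" where
  "Ttidx S = subsets_of (nat (aS S - 1)) (- bS S - 1) (aS S - 2)"

definition charD :: "'i set \<Rightarrow> ('i \<Rightarrow> 'i \<Rightarrow> 'a::field) \<Rightarrow> 'a poly" where
  "charD Idx M = detS Idx (\<lambda>I J. (if I = J then 1 else 0) - monom (M I J) 1)"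

definition D :: "int set \<Rightarrow> (int \<Rightarrow> 'a::field) \<Rightarrow> 'a poly" where
  "D S \<omega> = charD (Tidx S) (Tmat S \<omega>)"

definition Dt :: "int set \<Rightarrow> (int \<Rightarrow> 'a::field) \<Rightarrow> 'a poly" where
  "Dt S \<omega> = charD (Ttidx S) (Ttmat S \<omega>)"

definition Aplus :: "(int \<Rightarrow> 'a::field) \<Rightarrow> nat \<Rightarrow> 'a mat" where
  "Aplus \<omega> k = mat (k div 2 + 1) (k div 2 + 1) (\<lambda>(i, j).
     if 2 * j < k then \<omega> (int j - int i) + \<omega> (int k - int j - int i)
     else \<omega> (int j - int i))"

definition Aminus :: "(int \<Rightarrow> 'a::field) \<Rightarrow> nat \<Rightarrow> 'a mat" where
  "Aminus \<omega> k = mat ((k + 1) div 2) ((k + 1) div 2) (\<lambda>(i, j).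
     \<omega> (int j - int i) - \<omega> (int k - int j - int i))"

definition Fplus :: "(int \<Rightarrow> 'a::field) \<Rightarrow> nat \<Rightarrow> 'a" where
  "Fplus \<omega> k = (if k = 0 then 1 else det (1\<^sub>m (dim_row (Aplus \<omega> (k - 1))) - Aplus \<omega> (k - 1)))"

definition Fminus :: "(int \<Rightarrow> 'a::field) \<Rightarrow> nat \<Rightarrow> 'a" where
  "Fminus \<omega> k = (if k = 0 then 1 else det (1\<^sub>m (dim_row (Aminus \<omega> (k - 1))) - Aminus \<omega> (k - 1)))"

definition Fplus_cof :: "(int \<Rightarrow> 'a::field) \<Rightarrow> nat \<Rightarrow> nat \<Rightarrow> 'a" where
  "Fplus_cof \<omega> k l = cofactor (1\<^sub>m (dim_row (Aplus \<omega> k)) - Aplus \<omega> k) l 0"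

definition Fminus_cof :: "(int \<Rightarrow> 'a::field) \<Rightarrow> nat \<Rightarrow> nat \<Rightarrow> 'a" where
  "Fminus_cof \<omega> k l = cofactor (1\<^sub>m (dim_row (Aminus \<omega> k)) - Aminus \<omega> k) l 0"

text \<open>Bivariate objects: K[u,z] is 'a poly poly (outer variable z, coefficients in K[u]);
  series in z with coefficients in K[u] are 'a poly fps.\<close>

definition const_poly :: "'a::zero poly \<Rightarrow> 'a poly poly" where
  "const_poly p = map_poly (\<lambda>c. [:c:]) p"

definition Dz2 :: "int set \<Rightarrow> (int \<Rightarrow> 'a::field) \<Rightarrow> 'a poly" where
  "Dz2 S \<omega> = pcompose (D S \<omega>) [:0, 0, 1:]"

definition Den2 :: "int set \<Rightarrow> (int \<Rightarrow> 'a::field) \<Rightarrow> 'a poly poly" where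
  "Den2 S \<omega> = pcompose (const_poly (Dt S \<omega>)) [:0, 0, [:0, 1:]:] * const_poly (Dz2 S \<omega>)"

definition Gplus :: "(int \<Rightarrow> 'a::field) \<Rightarrow> 'a poly fps" where
  "Gplus \<omega> = Abs_fps (\<lambda>k. \<Sum>l\<in>{l. 2 * l \<le> k}. monom (Fplus_cof \<omega> k l) l)"

definition Gminus :: "(int \<Rightarrow> 'a::field) \<Rightarrow> 'a poly fps" where
  "Gminus \<omega> = Abs_fps (\<lambda>k. \<Sum>l\<in>{l. 2 * l < k}. monom (Fminus_cof \<omega> k l) l)"

end

theory Submission
  imports Defs
begin

text \<open>
  The matrices 1 - A are banded Toeplitz matrices whose bottom right corner is perturbed by a pattern
  that depends only on the parity of k. Expand such a determinant along its top row: when i rows are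
  used up, the unused columns are all those from i + a on together with a further a columns in the
  window [i - b, i + a - 1], and the position of these a columns relative to i is the state on
  which the matrix T acts. As long as the top row does not meet the corner, the vector of
  minors for k + 2 is therefore T times the vector for k, and Cramer's rule for 1 - z^2 T
  gives the denominator D(z^2).

  For the (l, 0) cofactor one column is missing from the start, so the first l rows are
  governed by (a - 1)-subsets and by the second transfer matrix, each step contributing u z^2; once row l is
  skipped, the remaining minor is one of those considered before.
\<close>

section \<open>Minors and the transfer matrix\<close>

text \<open>Laplace expansion with the columns kept as a set of integers, so that using up a column
  is set difference and moving down the diagonal is a translation. If \<open>C\<close> has
  \<open>n\<close> elements, this is the determinant on the columns \<open>C\<close> in increasing
  order.\<close>

fun minor :: "(nat \<Rightarrow> int \<Rightarrow> 'a::comm_ring_1) \<Rightarrow> nat \<Rightarrow> int set \<Rightarrow> 'a" where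
  "minor f 0 C = 1"
| "minor f (Suc n) C = (\<Sum>c\<in>C. eps c C * f 0 c * minor (\<lambda>i. f (Suc i)) n (C - {c}))"

lemma strict_mono_on_insert_index:
  fixes c :: "nat \<Rightarrow> 'b::order"
  assumes "strict_mono_on {..<Suc n} c" "j < Suc n"
  shows "strict_mono_on {..<n} (\<lambda>i. c (insert_index j i))"
  using assms by (fastforce simp: strict_mono_on_def insert_index_def)

lemma image_insert_index:
  assumes "inj_on c {..<Suc n}" "j < Suc n"
  shows "(\<lambda>i. c (insert_index j i)) ` {..<n} = c ` {..<Suc n} - {c j}"
proof -
  have "insert_index j ` {..<n} = {..<Suc n} - {j}"
    using insert_index_image[of j n] assms(2) by (simp add: lessThan_atLeast0)
  then have "(\<lambda>i. c (insert_index j i)) ` {..<n} = c ` ({..<Suc n} - {j})"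
    by (metis image_image)
  also have "\<dots> = c ` {..<Suc n} - {c j}"
    using assms by (simp add: inj_on_image_set_diff[of c "{..<Suc n}"])
  finally show ?thesis .
qed

lemma det_eq_minor:
  fixes f :: "nat \<Rightarrow> int \<Rightarrow> 'a::comm_ring_1"
  assumes "strict_mono_on {..<n} c"
  shows "det (mat n n (\<lambda>(i, j). f i (c j))) = minor f n (c ` {..<n})"
  using assms
proof (induction n arbitrary: f c)
  case 0
  show ?case by (simp add: det_dim_zero)
next
  case (Suc n)
  let ?A = "mat (Suc n) (Suc n) (\<lambda>(i, j). f i (c j))"
  have inj: "inj_on c {..<Suc n}"
    by (rule strict_mono_on_imp_inj_on[OF Suc.prems])
  have mono: "c i < c j \<longleftrightarrow> i < j" if "i < Suc n" "j < Suc n" for i j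
    using strict_mono_on_less[OF Suc.prems] that by simp
  have "?A $$ (0, j) * cofactor ?A 0 j =
      eps (c j) (c ` {..<Suc n}) * f 0 (c j) * minor (\<lambda>i. f (Suc i)) n (c ` {..<Suc n} - {c j})"
    if j: "j < Suc n" for j
  proof -
    have "mat_delete ?A 0 j = mat n n (\<lambda>(i, j'). f (Suc i) (c (insert_index j j')))"
      by (rule eq_matI) (auto simp: mat_delete_def insert_index_def)
    then have "det (mat_delete ?A 0 j) = minor (\<lambda>i. f (Suc i)) n (c ` {..<Suc n} - {c j})"
      using Suc.IH[OF strict_mono_on_insert_index[OF Suc.prems j], of "\<lambda>i. f (Suc i)"]
        image_insert_index[OF inj j] by simp
    \<comment> \<open>As \<open>c\<close> is increasing, exactly \<open>j\<close> chosen columns lie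
      to the left of \<open>c j\<close>, so \<open>eps\<close> is the usual sign.\<close>
    moreover have "{x \<in> c ` {..<Suc n}. x < c j} = c ` {..<j}"
      using j mono by auto
    then have "card {x \<in> c ` {..<Suc n}. x < c j} = j"
      using inj j by (simp add: card_image inj_on_subset)
    ultimately show ?thesis
      using j by (simp add: cofactor_def eps_def)
  qed
  then have "det ?A = (\<Sum>j<Suc n. eps (c j) (c ` {..<Suc n}) * f 0 (c j)
      * minor (\<lambda>i. f (Suc i)) n (c ` {..<Suc n} - {c j}))"
    using laplace_expansion_row[of ?A "Suc n" 0] by simp
  also have "\<dots> = minor f (Suc n) (c ` {..<Suc n})"
    unfolding minor.simps by (rule sum.reindex_cong[OF inj, symmetric]) auto
  finally show ?case .
qed

lemma eps_translate: "eps (c + d) ((\<lambda>x. x + d) ` C) = eps c C"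
proof -
  have "{i \<in> (\<lambda>x. x + d) ` C. i < c + d} = (\<lambda>x. x + d) ` {i \<in> C. i < c}"
    by auto
  then show ?thesis
    by (simp add: eps_def card_image inj_on_def)
qed

lemma minor_translate: "minor f n ((\<lambda>c. c + d) ` C) = minor (\<lambda>i c. f i (c + d)) n C"
proof (induction n arbitrary: f C)
  case (Suc n)
  have "(\<lambda>c. c + d) ` C - {c + d} = (\<lambda>c. c + d) ` (C - {c})" for c
    by auto
  then show ?case
    by (simp add: sum.reindex inj_on_def eps_translate Suc.IH)
qed simp

text \<open>In the top-row expansion the term using up \<open>c\<close> has factor 0, and every
  other term keeps the zero column.\<close>

lemma minor_zero_column:
  assumes "finite C" "card C = n" "c \<in> C" "\<And>i. i < n \<Longrightarrow> f i c = 0"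
  shows "minor f n C = 0"
  using assms
proof (induction n arbitrary: f C)
  case (Suc n)
  have "minor (\<lambda>i. f (Suc i)) n (C - {x}) = 0" if "x \<in> C" "x \<noteq> c" for x
    by (rule Suc.IH) (use Suc.prems that in auto)
  then have "f 0 x * minor (\<lambda>i. f (Suc i)) n (C - {x}) = 0" if "x \<in> C" for x
    using that Suc.prems(4)[of 0] by (cases "x = c") auto
  then show ?case
    by (simp add: mult.assoc)
qed auto

lemma finite_subsets_of: "finite (subsets_of m lo hi)"
  by (rule finite_subset[of _ "Pow {lo..hi}"]) (auto simp: subsets_of_def)

text \<open>A nonzero entry in row \<open>I\<close> comes from one removed element \<open>s\<close>,
  which determines the new state. The hypothesis on \<open>g\<close> covers the removals that lead
  out of the window and so have no matrix column.\<close>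

lemma sum_tentry:
  fixes g :: "int set \<Rightarrow> 'a::field"
  assumes I: "I \<in> subsets_of m lo (tp - 1)" and lo: "lo < tp"
    and g0: "\<And>s. s \<in> insert tp I \<Longrightarrow> lo \<in> I \<Longrightarrow> s \<noteq> lo \<Longrightarrow>
      g ((\<lambda>x. x - 1) ` (insert tp I - {s})) = 0"
  shows "(\<Sum>J\<in>subsets_of m lo (tp - 1). tentry bt tp I J * g J) =
    (\<Sum>s\<in>insert tp I. eps s I * bt s * g ((\<lambda>x. x - 1) ` (insert tp I - {s})))"
proof -
  let ?X = "subsets_of m lo (tp - 1)"
  let ?h = "\<lambda>s. (\<lambda>x. x - 1) ` (insert tp I - {s})"
  let ?S = "{s \<in> insert tp I. ?h s \<in> ?X}"
  have Isub: "I \<subseteq> {lo..tp - 1}" and cI: "card I = m"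
    using I by (auto simp: subsets_of_def)
  have fI: "finite I" using Isub finite_subset by blast
  have tpI: "tp \<notin> I" using Isub by auto
  have card_h: "card (?h s) = m" if "s \<in> insert tp I" for s
  proof -
    have "card (?h s) = card (insert tp I - {s})"
      by (rule card_image) (simp add: inj_on_def)
    also have "\<dots> = m" using that fI tpI cI by simp
    finally show ?thesis .
  qed
  \<comment> \<open>The shift to the left expels an element from the window only if that element was
    \<open>lo\<close> and has not been removed.\<close>
  have out: "g (?h s) = 0" if s: "s \<in> insert tp I" "?h s \<notin> ?X" for s
  proof -
    have "\<not> ?h s \<subseteq> {lo..tp - 1}" using s card_h by (auto simp: subsets_of_def)
    then have "lo \<in> I \<and> s \<noteq> lo" using Isub lo by force
    then show ?thesis using g0 s(1) by blast
  qed
  have unshift: "(\<lambda>j. j + 1) ` ?h s = insert tp I - {s}" for s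
    by (auto simp: image_image)
  have inj: "inj_on ?h ?S"
  proof (rule inj_onI)
    fix s t assume st: "s \<in> ?S" "t \<in> ?S" "?h s = ?h t"
    then have "insert tp I - {s} = insert tp I - {t}"
      using unshift by metis
    then show "s = t" using st by auto
  qed
  \<comment> \<open>The shifted state misses \<open>s\<close>, so the \<open>s\<close> in the
    definition is unique and \<open>THE\<close> returns it.\<close>
  have tent: "tentry bt tp I (?h s) = eps s I * bt s" if "s \<in> insert tp I" for s
  proof -
    have *: "insert tp I = insert t ((\<lambda>j. j + 1) ` ?h s) \<longleftrightarrow> t = s" for t
      unfolding unshift using that by auto
    show ?thesis by (simp only: tentry_def *) simp
  qed
  have tent0: "tentry bt tp I J = 0" if J: "J \<in> ?X" "J \<notin> ?h ` ?S" for J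
  proof (rule ccontr)
    assume "tentry bt tp I J \<noteq> 0"
    then obtain s where s: "insert tp I = insert s ((\<lambda>j. j + 1) ` J)"
      by (auto simp: tentry_def split: if_splits)
    have "finite J" using J(1) finite_subset by (auto simp: subsets_of_def)
    \<comment> \<open>The sizes \<open>m\<close> and \<open>Suc m\<close> keep \<open>s\<close>
      outside the shifted \<open>J\<close>, so \<open>J\<close> is recovered from
      \<open>s\<close>.\<close>
    have "card ((\<lambda>j. j + 1) ` J) = m"
      using J(1) by (simp add: card_image subsets_of_def)
    moreover have "card (insert tp I) = Suc m" using fI tpI cI by simp
    ultimately have "s \<notin> (\<lambda>j. j + 1) ` J"
      using s by (metis insert_absorb n_not_Suc_n)
    then have "insert tp I - {s} = (\<lambda>j. j + 1) ` J" using s by auto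
    then have "?h s = J" by (simp add: image_image)
    then show False using J s by blast
  qed
  have "(\<Sum>s\<in>insert tp I. eps s I * bt s * g (?h s)) = (\<Sum>s\<in>?S. tentry bt tp I (?h s) * g (?h s))"
    by (rule sum.mono_neutral_cong_right) (use fI out tent in auto)
  also have "\<dots> = (\<Sum>J\<in>?h ` ?S. tentry bt tp I J * g J)"
    using inj by (simp add: sum.reindex)
  also have "\<dots> = (\<Sum>J\<in>?X. tentry bt tp I J * g J)"
    by (rule sum.mono_neutral_left) (use tent0 finite_subsets_of in auto)
  finally show ?thesis by simp
qed

text \<open>The top row vanishes beyond \<open>tp\<close>, so the expansion removes only columns of
  \<open>insert tp I\<close>. If column \<open>lo\<close> is present and survives, it is zero in all
  later rows and the minor vanishes, which is the condition of \<open>sum_tentry\<close>.\<close>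

lemma minor_transfer:
  fixes f :: "nat \<Rightarrow> int \<Rightarrow> 'a::field"
  assumes I: "I \<in> subsets_of m lo (tp - 1)" and lo: "lo < tp" and N: "tp \<le> N"
    and n: "int m + N - tp = int n"
    and row: "\<And>c. lo \<le> c \<Longrightarrow> c \<le> N \<Longrightarrow> f 0 c = bt c"
    and bt: "\<And>c. tp < c \<Longrightarrow> c \<le> N \<Longrightarrow> bt c = 0"
    and col: "\<And>i. i < n \<Longrightarrow> f (Suc i) lo = 0"
  shows "minor f (Suc n) (I \<union> {tp..N}) = (\<Sum>J\<in>subsets_of m lo (tp - 1).
    tentry bt tp I J * minor (\<lambda>i c. f (Suc i) (c + 1)) n (J \<union> {tp..N - 1}))"
proof -
  let ?C = "I \<union> {tp..N}"
  let ?g = "\<lambda>J. minor (\<lambda>i c. f (Suc i) (c + 1)) n (J \<union> {tp..N - 1})"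
  have Isub: "I \<subseteq> {lo..tp - 1}" and cI: "card I = m"
    using I by (auto simp: subsets_of_def)
  have fI: "finite I" using Isub finite_subset by blast
  have "card ?C = card I + card {tp..N}"
    using Isub fI by (intro card_Un_disjoint) auto
  then have cC: "card ?C = Suc n" using n N cI by auto
  have g: "?g ((\<lambda>x. x - 1) ` (insert tp I - {s})) = minor (\<lambda>i. f (Suc i)) n (?C - {s})"
    if s: "s \<in> insert tp I" for s
  proof -
    \<comment> \<open>Column \<open>tp\<close> joins the window and the full block starts one later;
      translating by one restores the normal form.\<close>
    have "?C - {s} = (insert tp I - {s}) \<union> {tp + 1..N}"
      using s Isub N by force
    moreover have "{tp + 1..N} = (\<lambda>x. x + 1) ` {tp..N - 1}"
      by simp
    ultimately have "?C - {s} = (\<lambda>c. c + 1) ` ((\<lambda>x. x - 1) ` (insert tp I - {s}) \<union> {tp..N - 1})"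
      by (simp only: image_Un image_image diff_add_cancel image_ident)
    then show ?thesis by (simp only: minor_translate)
  qed
  have "?g ((\<lambda>x. x - 1) ` (insert tp I - {s})) = 0"
    if "s \<in> insert tp I" "lo \<in> I" "s \<noteq> lo" for s
    unfolding g[OF that(1)]
    by (rule minor_zero_column[where c = lo]) (use that cC fI col N in auto)
  then have "(\<Sum>J\<in>subsets_of m lo (tp - 1). tentry bt tp I J * ?g J) =
      (\<Sum>s\<in>insert tp I. eps s I * bt s * minor (\<lambda>i. f (Suc i)) n (?C - {s}))"
    using sum_tentry[OF I lo, of ?g bt] g by simp
  also have "\<dots> = (\<Sum>s\<in>?C. eps s ?C * f 0 s * minor (\<lambda>i. f (Suc i)) n (?C - {s}))"
  proof (rule sum.mono_neutral_cong_left)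
    show "insert tp I \<subseteq> ?C" using N by auto
    show "\<forall>s\<in>?C - insert tp I. eps s ?C * f 0 s * minor (\<lambda>i. f (Suc i)) n (?C - {s}) = 0"
      using row bt lo by auto
    fix s assume s: "s \<in> insert tp I"
    \<comment> \<open>Here \<open>s\<close> is at most \<open>tp\<close>, so no column of the full
      block lies to its left and the signs agree.\<close>
    then have "{i \<in> ?C. i < s} = {i \<in> I. i < s}" using Isub by auto
    then have "eps s ?C = (eps s I :: 'a)" by (simp add: eps_def)
    moreover have "f 0 s = bt s" using s Isub lo N row by force
    ultimately show "eps s I * bt s * minor (\<lambda>i. f (Suc i)) n (?C - {s}) =
      eps s ?C * f 0 s * minor (\<lambda>i. f (Suc i)) n (?C - {s})" by simp
  qed (use fI in simp)
  finally show ?thesis by simp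
qed

section \<open>Cramer's rule and rational power series\<close>

text \<open>Composition with the transposition of \<open>a\<close> and \<open>b\<close> flips the
  sign and keeps the product, so the determinant equals its negative, and 2 can be
  cancelled.\<close>

lemma detS_zero_of_equal_columns:
  fixes M :: "'i \<Rightarrow> 'i \<Rightarrow> 'b::{idom,semiring_char_0}"
  assumes "finite X" "a \<in> X" "b \<in> X" "a \<noteq> b" "\<And>i. i \<in> X \<Longrightarrow> M i a = M i b"
  shows "detS X M = 0"
proof -
  let ?t = "transpose a b"
  have t: "?t permutes X" using assms by (simp add: permutes_swap_id)
  have "detS X M = (\<Sum>p | p permutes X. of_int (sign (?t \<circ> p)) * (\<Prod>i\<in>X. M i ((?t \<circ> p) i)))"
    unfolding detS_def
    by (rule sum.reindex_bij_witness[of _ "\<lambda>p. ?t \<circ> p" "\<lambda>p. ?t \<circ> p"])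
      (simp_all add: permutes_compose[OF _ t] o_assoc)
  also have "\<dots> = (\<Sum>p | p permutes X. - (of_int (sign p) * (\<Prod>i\<in>X. M i (p i))))"
  proof (rule sum.cong[OF refl])
    fix p assume "p \<in> {p. p permutes X}"
    then have p: "p permutes X" by simp
    have "sign (?t \<circ> p) = - sign p"
      using assms t p by (simp add: sign_compose permutes_imp_permutation sign_swap_id)
    moreover have "M i (?t (p i)) = M i (p i)" if "i \<in> X" for i
      using assms(5)[OF that] by (simp add: transpose_def)
    ultimately show "of_int (sign (?t \<circ> p)) * (\<Prod>i\<in>X. M i ((?t \<circ> p) i)) =
        - (of_int (sign p) * (\<Prod>i\<in>X. M i (p i)))"
      by simp
  qed
  also have "\<dots> = - detS X M" by (simp add: detS_def sum_negf)
  finally have "detS X M + detS X M = 0" by (rule eq_neg_iff_add_eq_0[THEN iffD1])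
  then have "2 * detS X M = 0" by (simp only: mult_2)
  then show ?thesis by simp
qed

text \<open>Each permutation meets column \<open>c\<close> in exactly one row, so \<open>v\<close>
  enters every summand once and linearity in that column becomes visible.\<close>

lemma detS_replace_column:
  assumes "finite X" "c \<in> X"
  shows "detS X (\<lambda>i j. if j = c then v i else M i j) =
    (\<Sum>p | p permutes X. of_int (sign p) * v (inv_into UNIV p c) * (\<Prod>i\<in>X - {inv_into UNIV p c}. M i (p i)))"
  unfolding detS_def
proof (rule sum.cong[OF refl])
  fix p assume "p \<in> {p. p permutes X}"
  then have p: "p permutes X" by simp
  have q: "inv_into UNIV p c \<in> X" using permutes_in_image[OF permutes_inv[OF p]] assms(2) by simp
  have pi: "p i = c \<longleftrightarrow> i = inv_into UNIV p c" for i using permutes_inverses[OF p] by metis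
  have "(\<Prod>i\<in>X - {inv_into UNIV p c}. if p i = c then v i else M i (p i)) = (\<Prod>i\<in>X - {inv_into UNIV p c}. M i (p i))"
    by (rule prod.cong) (auto simp: pi)
  then show "of_int (sign p) * (\<Prod>i\<in>X. if p i = c then v i else M i (p i)) =
      of_int (sign p) * v (inv_into UNIV p c) * (\<Prod>i\<in>X - {inv_into UNIV p c}. M i (p i))"
    using prod.remove[OF assms(1) q, of "\<lambda>i. if p i = c then v i else M i (p i)"] pi
    by (simp add: mult.assoc)
qed

text \<open>By linearity in column \<open>c\<close>, the sum splits over \<open>k\<close>; for
  \<open>k \<noteq> c\<close> two columns coincide, so only \<open>k = c\<close> survives.\<close>

lemma cramer_detS:
  fixes M :: "'i \<Rightarrow> 'i \<Rightarrow> 'b::{idom,semiring_char_0}"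
  assumes X: "finite X" "c \<in> X"
  shows "detS X (\<lambda>i j. if j = c then \<Sum>k\<in>X. M i k * v k else M i j) = detS X M * v c"
proof -
  have "detS X (\<lambda>i j. if j = c then \<Sum>k\<in>X. M i k * v k else M i j) =
      (\<Sum>k\<in>X. detS X (\<lambda>i j. if j = c then M i k else M i j) * v k)"
    unfolding detS_replace_column[OF X] sum_distrib_right sum_distrib_left
    by (subst sum.swap) (simp add: mult_ac)
  also have "\<dots> = (\<Sum>k\<in>X. if k = c then detS X M * v c else 0)"
  proof (rule sum.cong[OF refl])
    fix k assume k: "k \<in> X"
    show "detS X (\<lambda>i j. if j = c then M i k else M i j) * v k = (if k = c then detS X M * v c else 0)"
    proof (cases "k = c")
      case True
      have "(\<lambda>i j. if j = c then M i c else M i j) = M" by (simp add: fun_eq_iff)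
      then show ?thesis unfolding True by simp
    next
      case False
      have "detS X (\<lambda>i j. if j = c then M i k else M i j) = 0"
        by (rule detS_zero_of_equal_columns[OF X(1) X(2) k]) (use False in auto)
      with False show ?thesis by simp
    qed
  qed
  also have "\<dots> = detS X M * v c" using X by simp
  finally show ?thesis .
qed

section \<open>Determinants under ring homomorphisms and substitution\<close>

lemma (in comm_ring_hom) hom_detS: "hom (detS X M) = detS X (\<lambda>i j. hom (M i j))"
  by (simp only: detS_def hom_sum hom_mult hom_prod hom_of_int)

lemma comm_ring_hom_fps_of_poly: "comm_ring_hom (fps_of_poly :: 'b::comm_ring_1 poly \<Rightarrow> 'b fps)"
  by unfold_locales (simp_all add: fps_of_poly_add fps_of_poly_mult)

lemma detS_fps_of_poly: "detS X (\<lambda>i j. fps_of_poly (M i j)) = fps_of_poly (detS X M)"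
  by (simp add: comm_ring_hom.hom_detS[OF comm_ring_hom_fps_of_poly])

lemma coeff_const_poly: "coeff (const_poly p) n = [:coeff p n:]"
  by (simp add: const_poly_def coeff_map_poly)

lemma comm_ring_hom_const_poly: "comm_ring_hom (const_poly :: 'b::comm_ring_1 poly \<Rightarrow> 'b poly poly)"
proof -
  interpret c: comm_ring_hom "\<lambda>c::'b. [:c:]" by unfold_locales auto
  have "const_poly (p * q) = const_poly p * const_poly q" for p q :: "'b poly"
    by (rule poly_eqI) (simp only: coeff_const_poly coeff_mult c.hom_sum c.hom_mult)
  moreover have "const_poly (p + q) = const_poly p + const_poly q" for p q :: "'b poly"
    by (rule poly_eqI) (simp add: coeff_const_poly)
  moreover have "const_poly 1 = (1 :: 'b poly poly)"
    by (simp add: const_poly_def)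
  moreover have "const_poly 0 = (0 :: 'b poly poly)"
    by (simp add: const_poly_def)
  ultimately show ?thesis
    by unfold_locales
qed

lemma comm_ring_hom_pcompose: "comm_ring_hom (\<lambda>p :: 'b::comm_ring_1 poly. pcompose p q)"
  by unfold_locales (simp_all add: pcompose_add pcompose_mult pcompose_1)

lemma pcompose_detS:
  "pcompose (detS X (\<lambda>i j. (if i = j then 1 else 0) - monom (M i j) 1)) q =
    detS X (\<lambda>i j. (if i = j then 1 else 0) - [:M i j:] * q)"
proof -
  have "pcompose ((if i = j then 1 else 0) - monom (M i j) 1) q = (if i = j then 1 else 0) - [:M i j:] * q"
    for i j
    by (simp add: pcompose_diff pcompose_1 monom_altdef pcompose_pCons pcompose_smult)
  then show ?thesis by (simp add: comm_ring_hom.hom_detS[OF comm_ring_hom_pcompose])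
qed

lemma const_poly_detS: "const_poly (detS X M) = detS X (\<lambda>i j. const_poly (M i j))"
  by (rule comm_ring_hom.hom_detS[OF comm_ring_hom_const_poly])

lemma detS_identity:
  assumes "finite X"
  shows "detS X (\<lambda>i j. if i = j then 1 else 0) = (1 :: 'b::comm_ring_1)"
proof -
  have "of_int (sign p) * (\<Prod>i\<in>X. if i = p i then 1 else 0) = (if p = id then 1 else 0 :: 'b)"
    if p: "p permutes X" for p
  proof (cases "p = id")
    case False
    then obtain i where "p i \<noteq> i" by (auto simp: fun_eq_iff)
    moreover then have "i \<in> X" using p by (auto simp: permutes_def)
    ultimately have "(\<Prod>i\<in>X. if i = p i then 1 else 0 :: 'b) = 0"
      using prod.remove[OF assms, of i "\<lambda>i. if i = p i then 1 else 0 :: 'b"] by simp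
    with False show ?thesis by simp
  qed simp
  then have "detS X (\<lambda>i j. if i = j then 1 else 0) = (\<Sum>p | p permutes X. if p = id then 1 else 0 :: 'b)"
    unfolding detS_def by (intro sum.cong refl) simp
  also have "\<dots> = 1" using assms by (simp add: permutes_id finite_permutations)
  finally show ?thesis .
qed

lemma charD_at_0:
  fixes M :: "'i \<Rightarrow> 'i \<Rightarrow> 'b::field"
  assumes "finite X"
  shows "poly (charD X M) 0 = 1"
proof -
  interpret comm_ring_hom "\<lambda>p. poly p (0 :: 'b)" by unfold_locales auto
  have "poly ((if i = j then 1 else 0) - monom (M i j) 1) 0 = (if i = j then 1 else 0)" for i j
    by (simp add: poly_monom)
  then show ?thesis
    unfolding charD_def hom_detS by (simp only: detS_identity[OF assms])
qed

text \<open>The factor \<open>q\<close> clears the denominators on the right-hand side of the linear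
  system; the replaced column then consists of polynomials, and so does the determinant in Cramer's
  rule.\<close>

lemma poly_of_cramer:
  fixes V :: "'i \<Rightarrow> 'b::{idom,semiring_char_0} fps"
  assumes X: "finite X"
    and MV: "\<And>i. i \<in> X \<Longrightarrow> \<exists>p. q * (\<Sum>j\<in>X. fps_of_poly (M i j) * V j) = fps_of_poly p"
    and c: "c \<in> X"
  shows "\<exists>p. V c * fps_of_poly (detS X M) * q = fps_of_poly p"
proof -
  have "\<forall>i\<in>X. \<exists>p. (\<Sum>j\<in>X. fps_of_poly (M i j) * (q * V j)) = fps_of_poly p"
    using MV by (simp add: sum_distrib_left mult.left_commute)
  then obtain P where P: "\<forall>i\<in>X. (\<Sum>j\<in>X. fps_of_poly (M i j) * (q * V j)) = fps_of_poly (P i)"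
    by (rule bchoice[THEN exE])
  have "fps_of_poly (detS X M) * (q * V c) =
      detS X (\<lambda>i j. if j = c then \<Sum>k\<in>X. fps_of_poly (M i k) * (q * V k) else fps_of_poly (M i j))"
    by (subst cramer_detS[OF X c]) (simp add: detS_fps_of_poly)
  also have "\<dots> = detS X (\<lambda>i j. fps_of_poly (if j = c then P i else M i j))"
    unfolding detS_def by (intro sum.cong refl arg_cong2[where f = "(*)"] prod.cong) (simp_all add: P)
  also have "\<dots> = fps_of_poly (detS X (\<lambda>i j. if j = c then P i else M i j))"
    by (rule detS_fps_of_poly)
  finally have "V c * fps_of_poly (detS X M) * q = fps_of_poly (detS X (\<lambda>i j. if j = c then P i else M i j))"
    by (simp only: mult_ac)
  then show ?thesis ..
qed

section \<open>Power series that are polynomials\<close>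

definition polynomial_fps :: "'b::comm_ring_1 fps \<Rightarrow> bool" where
  "polynomial_fps F \<longleftrightarrow> (\<exists>p. F = fps_of_poly p)"

lemma polynomial_fps_of_poly [simp]: "polynomial_fps (fps_of_poly p)"
  by (auto simp: polynomial_fps_def)

lemma polynomial_fps_add: "polynomial_fps F \<Longrightarrow> polynomial_fps G \<Longrightarrow> polynomial_fps (F + G)"
  unfolding polynomial_fps_def by (metis fps_of_poly_add)

lemma polynomial_fps_mult: "polynomial_fps F \<Longrightarrow> polynomial_fps G \<Longrightarrow> polynomial_fps (F * G)"
  unfolding polynomial_fps_def by (metis fps_of_poly_mult)

lemma polynomial_fps_eventually_0:
  assumes "\<And>k. k \<ge> N \<Longrightarrow> fps_nth F k = 0"
  shows "polynomial_fps F"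
proof -
  have "F = fps_of_poly (truncate_fps N F)"
    by (rule fps_ext) (use assms in \<open>auto simp: coeff_truncate_fps not_less\<close>)
  then show ?thesis unfolding polynomial_fps_def by (rule exI)
qed

text \<open>Changing finitely many coefficients affects only the numerator, so recurrences need to
  hold only for large indices.\<close>

lemma polynomial_fps_mult_eventually_eq:
  assumes "\<And>k. k \<ge> N \<Longrightarrow> fps_nth F k = fps_nth G k"
    and "polynomial_fps (G * fps_of_poly Q)"
  shows "polynomial_fps (F * fps_of_poly Q)"
proof -
  have "polynomial_fps (F - G)"
    by (rule polynomial_fps_eventually_0[of N]) (simp add: assms(1))
  then have "polynomial_fps (G * fps_of_poly Q + (F - G) * fps_of_poly Q)"
    by (intro polynomial_fps_add polynomial_fps_mult assms(2) polynomial_fps_of_poly)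
  then show ?thesis by (simp add: algebra_simps)
qed

lemma polynomial_fps_const_poly:
  assumes "polynomial_fps (F * fps_of_poly Q)"
  shows "polynomial_fps (Abs_fps (\<lambda>k. [:fps_nth F k:]) * fps_of_poly (const_poly Q))"
proof -
  interpret c: comm_ring_hom "\<lambda>c::'a. [:c:]" by unfold_locales auto
  obtain P where P: "F * fps_of_poly Q = fps_of_poly P"
    using assms by (auto simp: polynomial_fps_def)
  have "Abs_fps (\<lambda>k. [:fps_nth F k:]) * fps_of_poly (const_poly Q) = fps_of_poly (const_poly P)"
  proof (rule fps_ext)
    fix k
    have "fps_nth (fps_of_poly (const_poly P)) k = [:fps_nth (F * fps_of_poly Q) k:]"
      by (simp add: P coeff_const_poly)
    then show "fps_nth (Abs_fps (\<lambda>k. [:fps_nth F k:]) * fps_of_poly (const_poly Q)) k =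
        fps_nth (fps_of_poly (const_poly P)) k"
      by (simp only: fps_mult_nth fps_nth_Abs_fps fps_of_poly_nth coeff_const_poly c.hom_sum c.hom_mult)
  qed
  then show ?thesis by simp
qed

text \<open>The hypothesis says that \<open>(1 - z^2 T) V\<close> becomes polynomial after
  multiplication by \<open>q\<close>; Cramer's rule contributes the further factor
  \<open>det (1 - z^2 T)\<close>.\<close>

lemma polynomial_fps_resolvent:
  fixes V :: "'i \<Rightarrow> 'b::{idom,semiring_char_0} fps"
  assumes X: "finite X"
    and rec: "\<And>i. i \<in> X \<Longrightarrow>
      polynomial_fps ((V i - (\<Sum>j\<in>X. fps_const (T i j) * fps_X ^ 2 * V j)) * q)"
    and c: "c \<in> X"
  shows "polynomial_fps (V c * fps_of_poly (detS X (\<lambda>i j. (if i = j then 1 else 0) - [:0, 0, T i j:])) * q)"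
  unfolding polynomial_fps_def
proof (rule poly_of_cramer[OF X _ c])
  fix i assume i: "i \<in> X"
  have "fps_of_poly ((if i = j then 1 else 0) - [:0, 0, T i j:]) * V j =
      (if i = j then V j else 0) - fps_const (T i j) * fps_X ^ 2 * V j" for j
    by (simp add: fps_of_poly_diff fps_of_poly_pCons algebra_simps power2_eq_square)
  then have "(\<Sum>j\<in>X. fps_of_poly ((if i = j then 1 else 0) - [:0, 0, T i j:]) * V j) =
      V i - (\<Sum>j\<in>X. fps_const (T i j) * fps_X ^ 2 * V j)"
    using X i by (simp add: sum_subtractf)
  then show "\<exists>p. q * (\<Sum>j\<in>X. fps_of_poly ((if i = j then 1 else 0) - [:0, 0, T i j:]) * V j) = fps_of_poly p"
    using rec[OF i] by (simp add: polynomial_fps_def mult.commute)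
qed

section \<open>Toeplitz matrices with a perturbed corner\<close>

text \<open>Treats both signs and both parities at once. The size \<open>n k\<close> grows by one
  when \<open>k\<close> grows by two, so the corner pattern stays in place.\<close>

locale cornered_toeplitz =
  fixes \<omega> :: "int \<Rightarrow> 'a::field_char_0" and a :: int and \<sigma> :: 'a and n :: "nat \<Rightarrow> nat"
  assumes a_pos: "1 \<le> a" and band: "\<And>s. a < \<bar>s\<bar> \<Longrightarrow> \<omega> s = 0"
    and n_step: "\<And>k. n (k + 2) = Suc (n k)" and n_le: "\<And>k. n k \<le> k div 2 + 1"
begin

text \<open>
  For \<open>\<sigma> = 1\<close> and \<open>\<sigma> = - 1\<close> these are the entries of 1 - A for the two signs. Columns may be negative: the
  states refer to positions to the left of the matrix.
\<close>

definition entry :: "nat \<Rightarrow> nat \<Rightarrow> int \<Rightarrow> 'a" where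
  "entry k i j = beta \<omega> (j - int i) - (if 2 * j < int k then \<sigma> * \<omega> (int k - j - int i) else 0)"

text \<open>From here on \<open>2 * j < k\<close> forces \<open>k - j > a\<close>, so the reflected
  term misses the top row; moreover \<open>n k\<close> exceeds \<open>a\<close>.\<close>

definition threshold :: nat where
  "threshold = nat (2 * a + 2)"

abbreviation states :: "int set set" where
  "states \<equiv> subsets_of (nat a) (- a) (a - 1)"

abbreviation cof_states :: "int set set" where
  "cof_states \<equiv> subsets_of (nat (a - 1)) (- a - 1) (a - 2)"

definition state_minor :: "nat \<Rightarrow> int set \<Rightarrow> 'a" where
  "state_minor k I = minor (entry k) (n k) (I \<union> {a..int (n k) - 1})"

text \<open>
  Columns are shifted by one because column 0 is deleted; the sign of the cofactor is spread over the
  first l rows, which turns \<open>beta \<omega> (s + 1)\<close> into \<open>betat \<omega> s\<close>.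
\<close>

definition cof_minor :: "nat \<Rightarrow> nat \<Rightarrow> int set \<Rightarrow> 'a" where
  "cof_minor k l I = (-1) ^ l *
    minor (\<lambda>i c. entry k (insert_index l i) (c + 1)) (n k - 1) (I \<union> {a - 1..int (n k) - 2})"

text \<open>The differences \<open>j - i\<close> and \<open>k - j - i\<close> and the condition
  \<open>2 * j < k\<close> are all invariant, so the matrix for \<open>k + 2\<close> without its
  first row and column is the matrix for \<open>k\<close>.\<close>

lemma entry_shift: "entry (k + 2) (Suc i) (c + 1) = entry k i c"
  by (simp add: entry_def algebra_simps)

lemma n_ge: "k div 2 \<le> n k"
proof (induction k rule: nat_induct2)
  case (step k)
  then show ?case using n_step[of k] by simp
qed auto

lemma n_ge_threshold: "threshold \<le> k \<Longrightarrow> a < int (n k)"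
  using n_ge[of k] a_pos by (simp add: threshold_def)

lemma beta_band: "a < \<bar>s\<bar> \<Longrightarrow> beta \<omega> s = 0"
  using a_pos by (auto simp: beta_def band)

lemma entry_top_row: "threshold \<le> k \<Longrightarrow> entry k 0 c = beta \<omega> c"
  using a_pos by (auto simp: entry_def threshold_def intro!: band)

text \<open>Both arguments of the weight leave the band: \<open>c - i\<close> lies below
  \<open>- a\<close>, and \<open>k - c - i\<close> exceeds \<open>a\<close> because \<open>i\<close>
  is at most \<open>k div 2\<close>. For \<open>c = - a\<close> the latter uses that
  \<open>k\<close> is positive.\<close>

lemma entry_left_column:
  assumes i: "i < n k" and c: "c < int i - a" and k: "c < - a \<or> threshold \<le> k \<and> c \<le> - a"
  shows "entry k i c = 0"
proof -
  have "i \<le> k div 2" using i n_le[of k] by linarith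
  then have "a < int k - c - int i"
    using k a_pos by (auto simp: threshold_def)
  moreover have "a < \<bar>c - int i\<bar>" using c k by linarith
  ultimately show ?thesis by (simp add: entry_def beta_band band)
qed

lemma state_minor_step:
  assumes I: "I \<in> states" and k: "threshold \<le> k"
  shows "state_minor (k + 2) I = (\<Sum>J\<in>states. tentry (beta \<omega>) a I J * state_minor k J)"
proof -
  have "minor (entry (k + 2)) (Suc (n k)) (I \<union> {a..int (n k)}) = (\<Sum>J\<in>states. tentry (beta \<omega>) a I J *
      minor (\<lambda>i c. entry (k + 2) (Suc i) (c + 1)) (n k) (J \<union> {a..int (n k) - 1}))"
  proof (rule minor_transfer[OF I])
    show "entry (k + 2) 0 c = beta \<omega> c" for c
      by (rule entry_top_row) (use k in simp)
    show "entry (k + 2) (Suc i) (- a) = 0" if "i < n k" for i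
      by (rule entry_left_column) (use that k n_step[of k] in auto)
  qed (use a_pos n_ge_threshold[OF k] in \<open>auto intro: beta_band\<close>)
  then show ?thesis
    unfolding entry_shift state_minor_def n_step by simp
qed

lemma tentry_betat: "tentry (betat \<omega>) tp I J = - tentry (\<lambda>s. beta \<omega> (s + 1)) tp I J"
  by (simp add: tentry_def betat_def Let_def)

text \<open>The top row precedes the skipped row \<open>Suc l\<close>, so it is still an unperturbed
  Toeplitz row; using it up lowers the skipped index to \<open>l\<close>.\<close>

lemma cof_minor_step:
  assumes I: "I \<in> cof_states" and k: "threshold \<le> k"
  shows "cof_minor (k + 2) (Suc l) I =
    (\<Sum>J\<in>cof_states. tentry (betat \<omega>) (a - 1) I J * cof_minor k l J)"
proof -
  let ?f = "\<lambda>i c. entry (k + 2) (insert_index (Suc l) i) (c + 1)"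
  have I': "I \<in> subsets_of (nat (a - 1)) (- a - 1) (a - 1 - 1)" using I by simp
  have n: "Suc (n k - 1) = n k" using n_ge_threshold[OF k] a_pos by simp
  have shift: "?f (Suc i) (c + 1) = entry k (insert_index l i) (c + 1)" for i c
    using entry_shift[of k "insert_index l i" "c + 1"] by (simp add: insert_index_def split: if_splits)
  have "minor ?f (Suc (n k - 1)) (I \<union> {a - 1..int (n k) - 1}) =
      (\<Sum>J\<in>subsets_of (nat (a - 1)) (- a - 1) (a - 1 - 1). tentry (\<lambda>s. beta \<omega> (s + 1)) (a - 1) I J *
        minor (\<lambda>i c. ?f (Suc i) (c + 1)) (n k - 1) (J \<union> {a - 1..int (n k) - 1 - 1}))"
  proof (rule minor_transfer[OF I'])
    show "?f 0 c = beta \<omega> (c + 1)" for c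
      using entry_top_row[of "k + 2"] k by (simp add: insert_index_def)
    show "?f (Suc i) (- a - 1) = 0" if "i < n k - 1" for i
      by (rule entry_left_column) (use that k n_step[of k] in \<open>auto simp: insert_index_def\<close>)
  qed (use a_pos n_ge_threshold[OF k] in \<open>auto intro: beta_band\<close>)
  then have "minor ?f (n k) (I \<union> {a - 1..int (n k) - 1}) =
      (\<Sum>J\<in>cof_states. tentry (\<lambda>s. beta \<omega> (s + 1)) (a - 1) I J *
        minor (\<lambda>i c. entry k (insert_index l i) (c + 1)) (n k - 1) (J \<union> {a - 1..int (n k) - 2}))"
    unfolding n shift by simp
  \<comment> \<open>The one additional sign in \<open>(-1) ^ Suc l\<close> is absorbed by
    \<open>betat\<close>.\<close>
  then show ?thesis
    unfolding cof_minor_def n_step by (simp add: tentry_betat sum_distrib_left sum_negf mult_ac)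
qed

lemma insert_in_states:
  assumes I: "I \<in> cof_states" "- a - 1 \<notin> I"
  shows "insert (a - 1) I \<in> states"
proof -
  have sub: "I \<subseteq> {- a - 1..a - 2}" and card: "card I = nat (a - 1)"
    using I by (auto simp: subsets_of_def)
  have "finite I" "a - 1 \<notin> I" using sub finite_subset by auto
  then have "card (insert (a - 1) I) = nat a" using card a_pos by simp
  moreover have "c \<noteq> - a - 1" if "c \<in> I" for c using I(2) that by auto
  then have "insert (a - 1) I \<subseteq> {- a..a - 1}" using sub a_pos by force
  ultimately show ?thesis by (simp add: subsets_of_def)
qed

text \<open>The recursion on \<open>l\<close> ends here: without its first row and column the matrix
  for \<open>k + 2\<close> is the one for \<open>k\<close>, and column \<open>a - 1\<close> joins
  the window. A state containing \<open>- a - 1\<close> contains a zero column.\<close>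

lemma cof_minor_0:
  assumes I: "I \<in> cof_states" and k: "threshold \<le> k"
  shows "cof_minor (k + 2) 0 I = (if - a - 1 \<in> I then 0 else state_minor k (insert (a - 1) I))"
proof -
  have sub: "I \<subseteq> {- a - 1..a - 2}" and card: "card I = nat (a - 1)"
    using I by (auto simp: subsets_of_def)
  have fin: "finite I" using sub finite_subset by auto
  let ?C = "I \<union> {a - 1..int (n k) - 1}"
  have n: "a < int (n k)" by (rule n_ge_threshold[OF k])
  have "entry (k + 2) (insert_index 0 i) (c + 1) = entry k i c" for i c
    using entry_shift by (simp add: insert_index_def)
  then have *: "cof_minor (k + 2) 0 I = minor (entry k) (n k) ?C"
    unfolding cof_minor_def n_step by simp
  have "card ?C = card I + card {a - 1..int (n k) - 1}"
    using sub fin by (intro card_Un_disjoint) auto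
  then have card_C: "card ?C = n k" using card n a_pos by simp
  show ?thesis
  proof (cases "- a - 1 \<in> I")
    case True
    have "minor (entry k) (n k) ?C = 0"
    proof (rule minor_zero_column[where c = "- a - 1"])
      show "entry k i (- a - 1) = 0" if "i < n k" for i
        by (rule entry_left_column) (use that in auto)
    qed (use fin card_C True in auto)
    with True * show ?thesis by simp
  next
    case False
    have "?C = insert (a - 1) I \<union> {a..int (n k) - 1}" using n by auto
    with False * show ?thesis by (simp add: state_minor_def)
  qed
qed

section \<open>Generating functions of the state vectors\<close>

definition state_gf :: "int set \<Rightarrow> 'a fps" where
  "state_gf I = Abs_fps (\<lambda>k. if k < threshold then 0 else state_minor k I)"

definition cof_gf :: "int set \<Rightarrow> 'a poly fps" where
  "cof_gf I = Abs_fps (\<lambda>k. if k < threshold then 0 else \<Sum>l<n k. monom (cof_minor k l I) l)"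

definition denom :: "'a poly" where
  "denom = pcompose (charD states (tentry (beta \<omega>) a)) [:0, 0, 1:]"

text \<open>The substituted polynomial is \<open>u * z^2\<close>, with \<open>u\<close> the inner
  and \<open>z\<close> the outer variable.\<close>

definition cof_denom :: "'a poly poly" where
  "cof_denom = pcompose (const_poly (charD cof_states (tentry (betat \<omega>) (a - 1)))) [:0, 0, [:0, 1:]:]"

lemma state_gf_rational:
  assumes I: "I \<in> states"
  shows "polynomial_fps (state_gf I * fps_of_poly denom)"
proof -
  let ?T = "tentry (beta \<omega>) a"
  have "polynomial_fps ((state_gf J - (\<Sum>K\<in>states. fps_const (?T J K) * fps_X ^ 2 * state_gf K)) * 1)"
    if J: "J \<in> states" for J
  \<comment> \<open>The transfer step cancels all coefficients from \<open>threshold + 2\<close>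
    on.\<close>
  proof (rule polynomial_fps_eventually_0[of "threshold + 2"])
    fix k assume "threshold + 2 \<le> k"
    then obtain k' where k': "k = k' + 2" "threshold \<le> k'"
      by (metis add.commute add_le_imp_le_right le_add_diff_inverse2 le_trans le_add2)
    show "fps_nth ((state_gf J - (\<Sum>K\<in>states. fps_const (?T J K) * fps_X ^ 2 * state_gf K)) * 1) k = 0"
      using k' state_minor_step[OF J k'(2)]
      by (simp add: fps_sum_nth mult.assoc fps_X_power_mult_nth state_gf_def)
  qed
  from polynomial_fps_resolvent[OF finite_subsets_of this I]
  show ?thesis unfolding denom_def charD_def pcompose_detS by simp
qed

text \<open>An inhomogeneous system: the terms with positive \<open>l\<close> give the second
  transfer matrix times \<open>u * z^2\<close>, and those with \<open>l = 0\<close> give an ordinary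
  state series, whose denominator \<open>denom\<close> serves as the factor \<open>q\<close>. Hence
  the product of two denominators.\<close>

lemma cof_gf_rational:
  assumes I: "I \<in> cof_states"
  shows "polynomial_fps (cof_gf I * fps_of_poly (cof_denom * const_poly denom))"
proof -
  let ?T = "tentry (betat \<omega>) (a - 1)"
  let ?q = "fps_of_poly (const_poly denom)"
  have "polynomial_fps ((cof_gf J - (\<Sum>K\<in>cof_states. fps_const [:0, ?T J K:] * fps_X ^ 2 * cof_gf K)) * ?q)"
    if J: "J \<in> cof_states" for J
  proof (rule polynomial_fps_mult_eventually_eq[of "threshold + 2"])
    let ?F = "if - a - 1 \<in> J then 0 else fps_X ^ 2 * state_gf (insert (a - 1) J)"
    show "polynomial_fps (Abs_fps (\<lambda>k. [:fps_nth ?F k:]) * ?q)"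
    proof (rule polynomial_fps_const_poly)
      have "polynomial_fps (fps_X ^ 2 * (state_gf (insert (a - 1) J) * fps_of_poly denom))"
        if "- a - 1 \<notin> J"
        by (intro polynomial_fps_mult state_gf_rational insert_in_states J that)
          (metis fps_of_poly_monom' polynomial_fps_of_poly)
      then show "polynomial_fps (?F * fps_of_poly denom)"
        using polynomial_fps_of_poly[of "0 :: 'a poly"] by (simp add: mult.assoc)
    qed
    fix k assume "threshold + 2 \<le> k"
    then obtain k' where k': "k = k' + 2" "threshold \<le> k'"
      by (metis add.commute add_le_imp_le_right le_add_diff_inverse2 le_trans le_add2)
    have mult_monom: "[:0, t:] * monom c l = monom (t * c) (Suc l)" for t c :: 'a and l
      by (simp add: monom_Suc smult_monom)
    \<comment> \<open>Since \<open>n k = Suc (n k')\<close>, splitting off \<open>l = 0\<close>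
      leaves exactly the range of the sum for \<open>k'\<close>.\<close>
    have "(\<Sum>l<Suc (n k'). monom (cof_minor k l J) l) =
        monom (cof_minor k 0 J) 0 + (\<Sum>l<n k'. monom (cof_minor k (Suc l) J) (Suc l))"
      by (rule sum.lessThan_Suc_shift)
    also have "(\<Sum>l<n k'. monom (cof_minor k (Suc l) J) (Suc l)) =
        (\<Sum>l<n k'. \<Sum>K\<in>cof_states. [:0, ?T J K:] * monom (cof_minor k' l K) l)"
      unfolding k'(1) cof_minor_step[OF J k'(2)]
      by (simp only: monom_sum mult_monom)
    also have "\<dots> = (\<Sum>K\<in>cof_states. [:0, ?T J K:] * (\<Sum>l<n k'. monom (cof_minor k' l K) l))"
      by (subst sum.swap) (simp add: sum_distrib_left)
    finally show "fps_nth (cof_gf J - (\<Sum>K\<in>cof_states. fps_const [:0, ?T J K:] * fps_X ^ 2 * cof_gf K)) k =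
        fps_nth (Abs_fps (\<lambda>k. [:fps_nth ?F k:])) k"
      using k' cof_minor_0[OF J k'(2)] n_step[of k']
      by (simp add: fps_sum_nth mult.assoc fps_X_power_mult_nth cof_gf_def state_gf_def monom_0)
  qed
  from polynomial_fps_resolvent[OF finite_subsets_of this I]
  have "polynomial_fps (cof_gf I * fps_of_poly (detS cof_states
      (\<lambda>i j. (if i = j then 1 else 0) - [:0, 0, [:0, ?T i j:]:])) * ?q)" .
  moreover have "const_poly ((if i = j then 1 else 0) - monom (?T i j) 1) =
      (if i = j then 1 else 0) - monom [:?T i j:] 1" for i j
    by (rule poly_eqI) (simp add: coeff_const_poly)
  then have "cof_denom = detS cof_states (\<lambda>i j. (if i = j then 1 else 0) - [:0, 0, [:0, ?T i j:]:])"
    by (simp only: cof_denom_def charD_def const_poly_detS pcompose_detS) simp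
  ultimately show ?thesis by (simp add: fps_of_poly_mult mult.assoc)
qed

section \<open>Determinants and cofactors as minors of the initial states\<close>

lemma det_eq_state_minor:
  assumes "threshold \<le> k"
  shows "det (mat (n k) (n k) (\<lambda>(i, j). entry k i (int j))) = state_minor k {0..a - 1}"
proof -
  have "int ` {..<n k} = {0..a - 1} \<union> {a..int (n k) - 1}"
    using n_ge_threshold[OF assms] a_pos
    by (auto simp: lessThan_atLeast0 image_int_atLeastLessThan)
  then show ?thesis
    using det_eq_minor[of "n k" int "entry k"] by (simp add: state_minor_def strict_mono_on_def)
qed

lemma cofactor_eq_cof_minor:
  assumes "threshold \<le> k" "l < n k"
  shows "cofactor (mat (n k) (n k) (\<lambda>(i, j). entry k i (int j))) l 0 = cof_minor k l {0..a - 2}"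
proof -
  let ?f = "\<lambda>i c. entry k (insert_index l i) (c + 1)"
  \<comment> \<open>With column 0 deleted and the shift by one, the columns are numbered from 0 to
    \<open>n k - 2\<close>; for \<open>a = 1\<close> the window is empty.\<close>
  have "int ` {..<n k - 1} = {0..a - 2} \<union> {a - 1..int (n k) - 2}"
    using n_ge_threshold[OF assms(1)] a_pos
    by (auto simp: lessThan_atLeast0 image_int_atLeastLessThan)
  then have "det (mat (n k - 1) (n k - 1) (\<lambda>(i, j). ?f i (int j))) =
      minor ?f (n k - 1) ({0..a - 2} \<union> {a - 1..int (n k) - 2})"
    using det_eq_minor[of "n k - 1" int ?f] by (simp add: strict_mono_on_def)
  moreover have "mat_delete (mat (n k) (n k) (\<lambda>(i, j). entry k i (int j))) l 0 =
      mat (n k - 1) (n k - 1) (\<lambda>(i, j). ?f i (int j))"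
    by (rule eq_matI) (auto simp: mat_delete_def insert_index_def add.commute)
  ultimately show ?thesis by (simp add: cofactor_def cof_minor_def)
qed

text \<open>The index of \<open>F\<close> is one ahead of the matrix parameter, hence the factor
  \<open>fps_X\<close>; the coefficients up to \<open>threshold\<close>, with \<open>F 0\<close>
  among them, go into the numerator.\<close>

lemma det_gf_rational:
  assumes F: "\<And>k. F (Suc k) = det (mat (n k) (n k) (\<lambda>(i, j). entry k i (int j)))"
  shows "polynomial_fps (Abs_fps F * fps_of_poly denom)"
proof (rule polynomial_fps_mult_eventually_eq[of "Suc threshold"])
  have "{0..a - 1} \<in> states" using a_pos by (auto simp: subsets_of_def)
  then have "polynomial_fps (fps_of_poly [:0, 1:] * (state_gf {0..a - 1} * fps_of_poly denom))"
    by (intro polynomial_fps_mult polynomial_fps_of_poly state_gf_rational)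
  then show "polynomial_fps (fps_X * state_gf {0..a - 1} * fps_of_poly denom)"
    by (simp add: mult.assoc)
  fix k assume "Suc threshold \<le> k"
  then obtain k' where "k = Suc k'" "threshold \<le> k'" by (cases k) auto
  then show "fps_nth (Abs_fps F) k = fps_nth (fps_X * state_gf {0..a - 1}) k"
    by (simp add: F det_eq_state_minor state_gf_def)
qed

lemma cofactor_gf_rational:
  assumes F: "\<And>k. F k = (\<Sum>l<n k.
    monom (cofactor (mat (n k) (n k) (\<lambda>(i, j). entry k i (int j))) l 0) l)"
  shows "polynomial_fps (Abs_fps F * fps_of_poly (cof_denom * const_poly denom))"
proof (rule polynomial_fps_mult_eventually_eq[of threshold])
  have "{0..a - 2} \<in> cof_states" using a_pos by (auto simp: subsets_of_def)
  then show "polynomial_fps (cof_gf {0..a - 2} * fps_of_poly (cof_denom * const_poly denom))"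
    by (rule cof_gf_rational)
  show "fps_nth (Abs_fps F) k = fps_nth (cof_gf {0..a - 2}) k" if "threshold \<le> k" for k
    using that by (simp add: F cofactor_eq_cof_minor cof_gf_def)
qed

end

section \<open>The two signs for a symmetric step set\<close>

theorem mainTheorem13:
  fixes S :: "int set" and \<omega> :: "int \<Rightarrow> 'a::field_char_0"
  assumes "finite S" and "S \<noteq> {}" and "Max S \<ge> 1"
    and "\<forall>s. s \<notin> S \<longrightarrow> \<omega> s = 0"
    and "uminus ` S = S" and "\<forall>s\<in>S. \<omega> (- s) = \<omega> s"
  shows "\<exists>(Np :: 'a poly) (Nm :: 'a poly) (Ntp :: 'a poly poly) (Ntm :: 'a poly poly).
     Abs_fps (Fplus \<omega>) = fps_of_poly Np / fps_of_poly (Dz2 S \<omega>) \<and>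
     Abs_fps (Fminus \<omega>) = fps_of_poly Nm / fps_of_poly (Dz2 S \<omega>) \<and>
     Gplus \<omega> * fps_of_poly (Den2 S \<omega>) = fps_of_poly Ntp \<and>
     Gminus \<omega> * fps_of_poly (Den2 S \<omega>) = fps_of_poly Ntm"
proof -
  have neg: "- s \<in> S" if "s \<in> S" for s using assms(5) that by blast
  \<comment> \<open>Symmetry of the set turns the upper bound into a two-sided band, and below it
    identifies \<open>b\<close> with \<open>a\<close>.\<close>
  have "\<bar>s\<bar> \<le> Max S" if "s \<in> S" for s
    using Max_ge[OF assms(1) that] Max_ge[OF assms(1) neg[OF that]] by linarith
  then have band: "\<omega> s = 0" if "Max S < \<bar>s\<bar>" for s
    using that assms(4) by fastforce
  have "Min S = - Max S"
  proof (rule Min_eqI)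
    show "- Max S \<le> s" if "s \<in> S" for s
      using Max_ge[OF assms(1) neg[OF that]] by linarith
    show "- Max S \<in> S" using neg Max_in assms(1,2) by blast
  qed (rule assms(1))
  then have bS: "bS S = Max S" and aS: "aS S = Max S" by (simp_all add: bS_def aS_def)
  \<comment> \<open>For the plus sign the size includes the middle column \<open>2 * j = k\<close>
    when \<open>k\<close> is even, where the reflected term is absent; for the minus sign every
    column satisfies \<open>2 * j < k\<close>.\<close>
  interpret P: cornered_toeplitz \<omega> "Max S" 1 "\<lambda>k. k div 2 + 1"
    using assms(3) band by unfold_locales auto
  interpret M: cornered_toeplitz \<omega> "Max S" "- 1" "\<lambda>k. (k + 1) div 2"
    using assms(3) band by unfold_locales auto
  have mat_P: "1\<^sub>m (dim_row (Aplus \<omega> k)) - Aplus \<omega> k =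
      mat (k div 2 + 1) (k div 2 + 1) (\<lambda>(i, j). P.entry k i (int j))" for k
    by (rule eq_matI) (auto simp: Aplus_def P.entry_def beta_def)
  have mat_M: "1\<^sub>m (dim_row (Aminus \<omega> k)) - Aminus \<omega> k =
      mat ((k + 1) div 2) ((k + 1) div 2) (\<lambda>(i, j). M.entry k i (int j))" for k
    by (rule eq_matI) (auto simp: Aminus_def M.entry_def beta_def)
  \<comment> \<open>The transfer matrices see only the weights and \<open>a\<close>, so both signs
    share their denominators.\<close>
  have Dz2: "Dz2 S \<omega> = P.denom" "Dz2 S \<omega> = M.denom"
    by (simp_all add: Dz2_def D_def Tidx_def Tmat_def[abs_def] P.denom_def M.denom_def aS bS)
  have Den2: "Den2 S \<omega> = P.cof_denom * const_poly P.denom" "Den2 S \<omega> = M.cof_denom * const_poly M.denom"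
    by (simp_all add: Den2_def Dt_def Ttidx_def Ttmat_def[abs_def] Dz2 [symmetric]
        P.cof_denom_def M.cof_denom_def aS bS)
  \<comment> \<open>Constant term 1 makes the denominator nonzero, so the product identities in one
    variable turn into quotients.\<close>
  have "coeff (Dz2 S \<omega>) 0 = 1"
    by (simp add: Dz2_def D_def Tidx_def charD_at_0[OF finite_subsets_of])
  then have nz: "fps_of_poly (Dz2 S \<omega>) \<noteq> 0"
    by auto
  have "polynomial_fps (Abs_fps (Fplus \<omega>) * fps_of_poly (Dz2 S \<omega>))"
    unfolding Dz2(1) by (rule P.det_gf_rational) (simp add: Fplus_def mat_P)
  then obtain Np where Np: "Abs_fps (Fplus \<omega>) * fps_of_poly (Dz2 S \<omega>) = fps_of_poly Np"
    by (auto simp: polynomial_fps_def)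
  have "polynomial_fps (Abs_fps (Fminus \<omega>) * fps_of_poly (Dz2 S \<omega>))"
    unfolding Dz2(2) by (rule M.det_gf_rational) (simp add: Fminus_def mat_M)
  then obtain Nm where Nm: "Abs_fps (Fminus \<omega>) * fps_of_poly (Dz2 S \<omega>) = fps_of_poly Nm"
    by (auto simp: polynomial_fps_def)
  have "{l. 2 * l \<le> k} = {..<k div 2 + 1}" for k :: nat by auto
  then have "polynomial_fps (Gplus \<omega> * fps_of_poly (Den2 S \<omega>))"
    unfolding Den2(1) Gplus_def
    by (intro P.cofactor_gf_rational) (simp add: Fplus_cof_def mat_P)
  then obtain Ntp where Ntp: "Gplus \<omega> * fps_of_poly (Den2 S \<omega>) = fps_of_poly Ntp"
    by (auto simp: polynomial_fps_def)
  have "{l. 2 * l < k} = {..<(k + 1) div 2}" for k :: nat by auto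
  then have "polynomial_fps (Gminus \<omega> * fps_of_poly (Den2 S \<omega>))"
    unfolding Den2(2) Gminus_def
    by (intro M.cofactor_gf_rational) (simp add: Fminus_cof_def mat_M)
  then obtain Ntm where Ntm: "Gminus \<omega> * fps_of_poly (Den2 S \<omega>) = fps_of_poly Ntm"
    by (auto simp: polynomial_fps_def)
  have "Abs_fps (Fplus \<omega>) = fps_of_poly Np / fps_of_poly (Dz2 S \<omega>)"
    using Np nz by (metis nonzero_mult_div_cancel_right)
  moreover have "Abs_fps (Fminus \<omega>) = fps_of_poly Nm / fps_of_poly (Dz2 S \<omega>)"
    using Nm nz by (metis nonzero_mult_div_cancel_right)
  ultimately show ?thesis using Ntp Ntm by blast
qed

end
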